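(* If a subset $A$ of a metric space $(X,d_X)$ has zero length in $X$, then $A$ is totally bounded, its closure $\bar A$ in $X$ has zero length in $X$, and $\bar A$ has $1$-dimensional Hausdorff measure zero.
   Context: A graph is a pair $\Gamma=(V,E)$ of a (possibly infinite) set $V$ of vertices and a set $E$ of edges, each edge being a nonempty subset of $V$ of cardinality at most $2$. A subset $C\subseteq V$ is connected if any $x,y\in C$ are joined by a sequence $c_0=x,\dots,c_n=y$ in $C$ with $\{c_{i-1},c_i\}\in E$ for $1\le i\le n$; maximal connected subsets of $V$ are the connected components of $\Gamma$. A graph in a metric space $(X,d_X)$ is a graph with $V\subseteq X$; its total length is $\ell(\Gamma)=\sum_{\{x,y\}\in E}d_X(x,y)\in[0,\infty]$ (supremum of finite subsums if $E$ is infinite). A set $A\subseteq X$ has zero length in $X$ if for every $\varepsilon>0$ there is a graph $\Gamma=(V,E)$ in $X$ with finitely many connected components such that $A\subseteq\overline V$ (closure in $X$) and $\ell(\Gamma)<\varepsilon$. A subset $A$ of a metric space $X$ has $1$-dimensional Hausdorff measure zero if for every $\varepsilon>0$ there exist a countable set $C\subseteq X$ and a function $\epsilon:C\to(0,1]$ such that $\sum_{c\in C}\epsilon(c)<\varepsilon$ and $A\subseteq\bigcup_{c\in C}B(c,\epsilon(c))$, where $B(x,\delta)=\{y\in X:d_X(x,y)<\delta\}$. *)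

theory Defs
  imports "HOL-Analysis.Analysis"
begin

text \<open>Loops are singleton edges, so the edges of a graph are unordered pairs of
  possibly equal vertices.\<close>

definition is_graph :: "'a set \<Rightarrow> 'a set set \<Rightarrow> bool" where
  "is_graph V E \<longleftrightarrow> (\<forall>e\<in>E. e \<subseteq> V \<and> e \<noteq> {} \<and> finite e \<and> card e \<le> 2)"

definition graph_connected :: "'a set set \<Rightarrow> 'a set \<Rightarrow> bool" where
  "graph_connected E C \<longleftrightarrow>
     (\<forall>x\<in>C. \<forall>y\<in>C. \<exists>(n::nat) c. c 0 = x \<and> c n = y \<and> (\<forall>i\<le>n. c i \<in> C) \<and>
        (\<forall>i\<in>{1..n}. {c (i - 1), c i} \<in> E))"

definition graph_components :: "'a set \<Rightarrow> 'a set set \<Rightarrow> 'a set set" where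
  "graph_components V E =
     {C. C \<subseteq> V \<and> graph_connected E C \<and>
         (\<forall>D. D \<subseteq> V \<longrightarrow> graph_connected E D \<longrightarrow> C \<subseteq> D \<longrightarrow> D = C)}"

text \<open>The value is meaningful only for sets \<open>e\<close> of the form \<open>{x, y}\<close>, where it is
  independent of the choice of \<open>x\<close> and \<open>y\<close>; a loop has length \<open>0\<close>.\<close>

definition edge_length :: "'a::metric_space set \<Rightarrow> real" where
  "edge_length e = (THE r. \<exists>x y. e = {x, y} \<and> r = dist x y)"

lemma edge_length_doubleton [simp]: "edge_length {x, y} = dist x y"
  unfolding edge_length_def
  by (rule the_equality) (auto simp: doubleton_eq_iff dist_commute)

text \<open>Sums are taken in \<^typ>\<open>ennreal\<close>, where \<^const>\<open>infsum\<close> is always the supremum of the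
  finite subsums. A real-valued \<^const>\<open>infsum\<close> would be \<open>0\<close> for divergent sums.\<close>

definition total_length :: "'a::metric_space set set \<Rightarrow> ennreal" where
  "total_length E = (\<Sum>\<^sub>\<infinity>e\<in>E. ennreal (edge_length e))"

lemma total_length_eq_SUP:
  "total_length E = (SUP F\<in>{F. finite F \<and> F \<subseteq> E}. \<Sum>e\<in>F. ennreal (edge_length e))"
  unfolding total_length_def by (rule nonneg_infsum_complete) simp

definition zero_length :: "'a::metric_space set \<Rightarrow> bool" where
  "zero_length A \<longleftrightarrow>
     (\<forall>\<epsilon>::real. \<epsilon> > 0 \<longrightarrow>
        (\<exists>V E. is_graph V E \<and> finite (graph_components V E) \<and>
           A \<subseteq> closure V \<and> total_length E < ennreal \<epsilon>))"

definition hausdorff1_zero :: "'a::metric_space set \<Rightarrow> bool" where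
  "hausdorff1_zero A \<longleftrightarrow>
     (\<forall>\<epsilon>::real. \<epsilon> > 0 \<longrightarrow>
        (\<exists>C (r :: 'a \<Rightarrow> real). countable C \<and> (\<forall>c\<in>C. 0 < r c \<and> r c \<le> 1) \<and>
           (\<Sum>\<^sub>\<infinity>c\<in>C. ennreal (r c)) < ennreal \<epsilon> \<and> A \<subseteq> (\<Union>c\<in>C. ball c (r c))))"

end

theory Submission
  imports Defs
begin

text \<open>Two vertices of a connected graph are joined by a walk without repeated vertices. Such a
  walk traverses each edge at most once, so by the triangle inequality the distance of its ends is
  at most the total length of the graph (\<open>dist_le_total_length\<close>). The components of a graph are
  pairwise disjoint, so the lengths of the subgraphs that they induce add up to at most the total
  length of the graph.

  Hence, when there are only finitely many components, the vertices are covered by finitely many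
  closed balls, one around a vertex of each component, whose radii are the lengths of the components
  and have a sum below \<open>\<epsilon>\<close>. A finite union of closed balls is closed, so it still contains the
  closure of the vertex set. Enlarging every ball by the same small amount makes the balls open and
  the radii positive. This finite cover (\<open>zero_length_imp_finite_cover\<close>) yields both total
  boundedness and Hausdorff measure zero; the closure of \<open>A\<close> has zero length because the closure of
  a vertex set is closed.\<close>

section \<open>Walks and distances\<close>

text \<open>Reachability is expressed by the reflexive transitive closure, whose library facts take over
  the concatenation and cutting of walks.\<close>

definition adjacent_in :: "'a set set \<Rightarrow> 'a set \<Rightarrow> ('a \<times> 'a) set" where
  "adjacent_in E C = {(x, y). x \<in> C \<and> y \<in> C \<and> {x, y} \<in> E}"

lemma graph_connected_iff_rtrancl:
  "graph_connected E C \<longleftrightarrow> (\<forall>x\<in>C. \<forall>y\<in>C. (x, y) \<in> (adjacent_in E C)\<^sup>*)"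
proof -
  have "(\<exists>(n::nat) c. c 0 = x \<and> c n = y \<and> (\<forall>i\<le>n. c i \<in> C) \<and> (\<forall>i\<in>{1..n}. {c (i - 1), c i} \<in> E))
        \<longleftrightarrow> (x, y) \<in> (adjacent_in E C)\<^sup>*" (is "?walk \<longleftrightarrow> _")
    if "x \<in> C" "y \<in> C" for x y
  proof
    assume ?walk
    then obtain n :: nat and c where c: "c 0 = x" "c n = y" "\<forall>i\<le>n. c i \<in> C"
      and edges: "\<forall>i\<in>{1..n}. {c (i - 1), c i} \<in> E" by blast
    have "(c i, c (Suc i)) \<in> adjacent_in E C" if "i < n" for i
      using c(3) bspec[OF edges, of "Suc i"] that by (simp add: adjacent_in_def)
    then have "(x, y) \<in> adjacent_in E C ^^ n"
      using c by (auto simp: relpow_fun_conv)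
    then show "(x, y) \<in> (adjacent_in E C)\<^sup>*" by (rule relpow_imp_rtrancl)
  next
    assume "(x, y) \<in> (adjacent_in E C)\<^sup>*"
    then obtain n c where c: "c 0 = x" "c n = y"
      and adj: "\<And>i. i < n \<Longrightarrow> (c i, c (Suc i)) \<in> adjacent_in E C"
      by (metis rtrancl_imp_relpow relpow_fun_conv)
    have "c i \<in> C" if "i \<le> n" for i
      using adj[of i] that \<open>y \<in> C\<close> c by (cases "i = n") (auto simp: adjacent_in_def)
    moreover have "{c (i - 1), c i} \<in> E" if "i \<in> {1..n}" for i
      using adj[of "i - 1"] that by (cases i) (auto simp: adjacent_in_def)
    ultimately show ?walk using c by blast
  qed
  then show ?thesis by (simp add: graph_connected_def)
qed

text \<open>A shortest walk repeats no vertex, since cutting out a closed part would shorten it.\<close>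

lemma rtrancl_imp_inj_walk:
  assumes "(x, y) \<in> R\<^sup>*"
  obtains n c where "c 0 = x" "c n = y" "\<And>i. i < n \<Longrightarrow> (c i, c (Suc i)) \<in> R" "inj_on c {..n}"
proof -
  define n where "n = (LEAST n. (x, y) \<in> R ^^ n)"
  have "(x, y) \<in> R ^^ n"
    unfolding n_def using rtrancl_imp_relpow[OF assms] by (metis LeastI)
  then obtain c where c: "c 0 = x" "c n = y" and step: "\<And>i. i < n \<Longrightarrow> (c i, c (Suc i)) \<in> R"
    by (auto simp: relpow_fun_conv)
  have "c i \<noteq> c j" if "i < j" "j \<le> n" for i j
  proof
    assume eq: "c i = c j"
    have "(x, c i) \<in> R ^^ i"
      using c step that by (auto simp: relpow_fun_conv intro!: exI[of _ c])
    moreover have "(c j, y) \<in> R ^^ (n - j)"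
      using c step that by (auto simp: relpow_fun_conv intro!: exI[of _ "\<lambda>k. c (j + k)"])
    ultimately have "(x, y) \<in> R ^^ (i + (n - j))"
      using eq by (auto simp: relpow_add)
    then have "n \<le> i + (n - j)" unfolding n_def by (rule Least_le)
    then show False using that by simp
  qed
  then have "inj_on c {..n}"
    by (metis atMost_iff inj_onI linorder_neqE_nat)
  then show thesis using that c step by blast
qed

lemma dist_le_sum_steps:
  fixes c :: "nat \<Rightarrow> 'a::metric_space"
  shows "dist (c 0) (c n) \<le> (\<Sum>i<n. dist (c i) (c (Suc i)))"
proof (induction n)
  case (Suc n)
  then show ?case using dist_triangle[of "c 0" "c (Suc n)" "c n"] by simp
qed simp

lemma dist_le_total_length:
  fixes C :: "'a::metric_space set"
  assumes "graph_connected E C" "x \<in> C" "y \<in> C"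
  shows "ennreal (dist x y) \<le> total_length {e \<in> E. e \<subseteq> C}"
proof -
  have "(x, y) \<in> (adjacent_in E C)\<^sup>*"
    using assms by (simp add: graph_connected_iff_rtrancl)
  then obtain n c where c: "c 0 = x" "c n = y"
    and step: "\<And>i. i < n \<Longrightarrow> (c i, c (Suc i)) \<in> adjacent_in E C"
    and inj: "inj_on c {..n}"
    using rtrancl_imp_inj_walk by metis
  define edge where "edge = (\<lambda>i. {c i, c (Suc i)})"
  have inj_edge: "inj_on edge {..<n}"
  proof (rule inj_onI)
    fix i j assume "i \<in> {..<n}" "j \<in> {..<n}" "edge i = edge j"
    then have "c i = c j \<or> c i = c (Suc j) \<and> c (Suc i) = c j"
      by (auto simp: edge_def doubleton_eq_iff)
    then show "i = j"
      using \<open>i \<in> {..<n}\<close> \<open>j \<in> {..<n}\<close> by (auto simp: inj_on_eq_iff[OF inj])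
  qed
  have "ennreal (dist x y) \<le> ennreal (\<Sum>i<n. dist (c i) (c (Suc i)))"
    using dist_le_sum_steps[of c n] c by (simp add: ennreal_leI)
  also have "\<dots> = (\<Sum>i<n. ennreal (edge_length (edge i)))"
    by (simp add: edge_def sum_ennreal)
  also have "\<dots> = (\<Sum>e\<in>edge ` {..<n}. ennreal (edge_length e))"
    by (simp add: sum.reindex[OF inj_edge])
  also have "\<dots> \<le> total_length {e \<in> E. e \<subseteq> C}"
    unfolding total_length_eq_SUP
    using step by (intro SUP_upper) (auto simp: edge_def adjacent_in_def)
  finally show ?thesis .
qed

section \<open>Connected components\<close>

lemma graph_connected_Union:
  assumes "\<And>C. C \<in> \<C> \<Longrightarrow> graph_connected E C" "\<And>C. C \<in> \<C> \<Longrightarrow> x \<in> C"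
  shows "graph_connected E (\<Union>\<C>)"
proof -
  have "(y, z) \<in> (adjacent_in E (\<Union>\<C>))\<^sup>*" if "C \<in> \<C>" "y \<in> C" "z \<in> C" for C y z
  proof -
    have "adjacent_in E C \<subseteq> adjacent_in E (\<Union>\<C>)"
      using that by (auto simp: adjacent_in_def)
    moreover have "(y, z) \<in> (adjacent_in E C)\<^sup>*"
      using assms(1) that by (simp add: graph_connected_iff_rtrancl)
    ultimately show ?thesis using rtrancl_mono by blast
  qed
  then show ?thesis
    unfolding graph_connected_iff_rtrancl using assms(2) by (meson UnionE rtrancl_trans)
qed

lemma graph_components_cover: "\<Union>(graph_components V E) = V"
proof
  show "V \<subseteq> \<Union>(graph_components V E)"
  proof
    fix x assume "x \<in> V"
    define K where "K = \<Union>{C. C \<subseteq> V \<and> graph_connected E C \<and> x \<in> C}"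
    have "graph_connected E {x}" by (simp add: graph_connected_iff_rtrancl)
    then have "x \<in> K" using \<open>x \<in> V\<close> by (auto simp: K_def)
    have "graph_connected E K" unfolding K_def by (rule graph_connected_Union) auto
    moreover have "D = K" if "D \<subseteq> V" "graph_connected E D" "K \<subseteq> D" for D
      using that \<open>x \<in> K\<close> by (auto simp: K_def)
    moreover have "K \<subseteq> V" by (auto simp: K_def)
    ultimately have "K \<in> graph_components V E" by (auto simp: graph_components_def)
    then show "x \<in> \<Union>(graph_components V E)" using \<open>x \<in> K\<close> by blast
  qed
qed (auto simp: graph_components_def)

lemma graph_components_disjoint:
  assumes "C \<in> graph_components V E" "D \<in> graph_components V E" "C \<noteq> D"
  shows "C \<inter> D = {}"
proof (rule ccontr)
  assume "C \<inter> D \<noteq> {}"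
  then obtain x where "x \<in> C" "x \<in> D" by blast
  then have "graph_connected E (\<Union>{C, D})"
    using assms by (intro graph_connected_Union[of _ _ x]) (auto simp: graph_components_def)
  then have "C \<union> D = C" "C \<union> D = D"
    using assms by (auto simp: graph_components_def)
  then show False using \<open>C \<noteq> D\<close> by blast
qed

text \<open>Edges are nonempty, so each of them lies in at most one of the components.\<close>

lemma sum_total_length_components_le:
  assumes "is_graph V E" "finite \<P>" "\<P> \<subseteq> graph_components V E"
  shows "(\<Sum>C\<in>\<P>. total_length {e \<in> E. e \<subseteq> C}) \<le> total_length E"
proof -
  have "{e \<in> E. e \<subseteq> C} \<inter> {e \<in> E. e \<subseteq> D} = {}" if "C \<in> \<P>" "D \<in> \<P>" "C \<noteq> D" for C D
  proof -
    have "C \<inter> D = {}" using that assms(3) by (intro graph_components_disjoint) auto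
    moreover have "{} \<notin> E" using assms(1) by (auto simp: is_graph_def)
    ultimately have "e \<notin> E" if "e \<subseteq> C" "e \<subseteq> D" for e
      using that by (metis Int_greatest subset_empty)
    then show ?thesis by blast
  qed
  then have "(\<Sum>C\<in>\<P>. total_length {e \<in> E. e \<subseteq> C})
      = (\<Sum>\<^sub>\<infinity>e\<in>(\<Union>C\<in>\<P>. {e \<in> E. e \<subseteq> C}). ennreal (edge_length e))"
    unfolding total_length_def
    by (intro sum_infsum assms nonneg_summable_on_complete) auto
  also have "\<dots> \<le> total_length E"
    unfolding total_length_def
    by (rule infsum_mono_neutral) (auto intro: nonneg_summable_on_complete)
  finally show ?thesis .
qed

section \<open>Covers of sets of zero length\<close>

text \<open>Finiteness of the cover is what total boundedness needs. It also lets the cover by closed balls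
  survive the passage to the closure, which would fail for a countable union.\<close>

lemma zero_length_imp_finite_cover:
  fixes A :: "'a::metric_space set"
  assumes "zero_length A" "\<epsilon> > 0"
  obtains S and r :: "'a \<Rightarrow> real" where "finite S" "\<And>c. c \<in> S \<Longrightarrow> 0 < r c" "sum r S < \<epsilon>"
    "closure A \<subseteq> (\<Union>c\<in>S. ball c (r c))"
proof -
  obtain V E where graph: "is_graph V E" and fin: "finite (graph_components V E)"
    and A: "A \<subseteq> closure V" and short: "total_length E < ennreal (\<epsilon> / 2)"
    using assms unfolding zero_length_def by (meson half_gt_zero)
  \<comment> \<open>The empty set is a component of the empty graph.\<close>
  define \<P> where "\<P> = graph_components V E - {{}}"
  define len where "len C = enn2real (total_length {e \<in> E. e \<subseteq> C})" for C
  define centre :: "'a set \<Rightarrow> 'a" where "centre C = (SOME x. x \<in> C)" for C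
  \<comment> \<open>Adding 1 to the number of components excludes division by zero.\<close>
  define \<eta> where "\<eta> = \<epsilon> / (2 * (real (card \<P>) + 1))"
  have "finite \<P>" using fin by (simp add: \<P>_def)
  have "\<eta> > 0" using assms(2) by (simp add: \<eta>_def)
  have centre: "centre C \<in> C" if "C \<in> \<P>" for C
    using that by (auto simp: centre_def \<P>_def some_in_eq)
  have inj: "inj_on centre \<P>"
  proof (rule inj_onI)
    fix C D assume CD: "C \<in> \<P>" "D \<in> \<P>" "centre C = centre D"
    then have "C \<inter> D \<noteq> {}" using centre by (metis disjoint_iff)
    then show "C = D" using CD graph_components_disjoint[of C V E D] by (auto simp: \<P>_def)
  qed
  have sum_len: "(\<Sum>C\<in>\<P>. total_length {e \<in> E. e \<subseteq> C}) < ennreal (\<epsilon> / 2)"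
    using sum_total_length_components_le[OF graph \<open>finite \<P>\<close>] short
    by (force simp: \<P>_def intro: le_less_trans)
  have len: "total_length {e \<in> E. e \<subseteq> C} = ennreal (len C)" if "C \<in> \<P>" for C
  proof -
    have "total_length {e \<in> E. e \<subseteq> C} \<le> (\<Sum>C\<in>\<P>. total_length {e \<in> E. e \<subseteq> C})"
      using that \<open>finite \<P>\<close> by (intro member_le_sum) auto
    then have "total_length {e \<in> E. e \<subseteq> C} < top"
      using sum_len by (meson le_less_trans ennreal_less_top less_trans)
    then show ?thesis by (simp add: len_def)
  qed
  have len_nonneg: "len C \<ge> 0" for C by (simp add: len_def)
  have "ennreal (sum len \<P>) < ennreal (\<epsilon> / 2)"
    using sum_len by (simp add: len len_nonneg flip: sum_ennreal)
  then have sum_len_real: "sum len \<P> < \<epsilon> / 2"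
    using len_nonneg by (simp add: ennreal_less_iff sum_nonneg)
  define r where "r c = len (the_inv_into \<P> centre c) + \<eta>" for c
  have r: "r (centre C) = len C + \<eta>" if "C \<in> \<P>" for C
    using that by (simp add: r_def the_inv_into_f_f[OF inj])
  have "sum r (centre ` \<P>) = sum len \<P> + real (card \<P>) * \<eta>"
    by (simp add: sum.reindex[OF inj] r sum.distrib)
  also have "real (card \<P>) * \<eta> \<le> \<epsilon> / 2"
    using assms(2) by (simp add: \<eta>_def field_simps)
  finally have "sum r (centre ` \<P>) < \<epsilon>" using sum_len_real by simp
  moreover have "0 < r c" for c using len_nonneg \<open>\<eta> > 0\<close> by (simp add: r_def add_nonneg_pos)
  moreover have "closure A \<subseteq> (\<Union>c\<in>centre ` \<P>. ball c (r c))"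
  proof -
    have "C \<subseteq> cball (centre C) (len C)" if "C \<in> \<P>" for C
    proof
      fix y assume "y \<in> C"
      have "graph_connected E C" using that by (auto simp: \<P>_def graph_components_def)
      then have "ennreal (dist (centre C) y) \<le> ennreal (len C)"
        using dist_le_total_length[OF _ centre[OF that] \<open>y \<in> C\<close>] len[OF that] by metis
      then show "y \<in> cball (centre C) (len C)" using len_nonneg by simp
    qed
    then have "V \<subseteq> (\<Union>C\<in>\<P>. cball (centre C) (len C))"
      using graph_components_cover[of V E] by (fastforce simp: \<P>_def)
    moreover have "closed (\<Union>C\<in>\<P>. cball (centre C) (len C))"
      using \<open>finite \<P>\<close> by (intro closed_UN) auto
    ultimately have "closure V \<subseteq> (\<Union>C\<in>\<P>. cball (centre C) (len C))"
      by (rule closure_minimal)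
    moreover have "closure A \<subseteq> closure V" using A by (intro closure_minimal) auto
    moreover have "cball (centre C) (len C) \<subseteq> ball (centre C) (r (centre C))" if "C \<in> \<P>" for C
      using \<open>\<eta> > 0\<close> by (auto simp: r[OF that])
    ultimately show ?thesis by blast
  qed
  ultimately show thesis using that[of "centre ` \<P>" r] \<open>finite \<P>\<close> by blast
qed

lemma zero_length_imp_totally_bounded:
  fixes A :: "'a::metric_space set"
  assumes "zero_length A"
  shows "totally_bounded A"
  unfolding totally_bounded_metric
proof (intro allI impI)
  fix \<epsilon> :: real assume "\<epsilon> > 0"
  then obtain S r where S: "finite S" "\<And>c. c \<in> S \<Longrightarrow> 0 < r c" "sum r S < \<epsilon>"
    and cover: "closure A \<subseteq> (\<Union>c\<in>S. ball c (r c))"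
    using zero_length_imp_finite_cover[OF assms] by blast
  have "r c \<le> \<epsilon>" if "c \<in> S" for c
    using member_le_sum[OF that, of r] S by force
  then have "A \<subseteq> (\<Union>c\<in>S. {y. dist c y < \<epsilon>})"
    using cover closure_subset[of A] by (force simp: subset_iff dest: less_le_trans)
  then show "\<exists>k. finite k \<and> A \<subseteq> (\<Union>x\<in>k. {y. dist x y < \<epsilon>})" using S(1) by blast
qed

lemma zero_length_imp_hausdorff1_zero_closure:
  fixes A :: "'a::metric_space set"
  assumes "zero_length A"
  shows "hausdorff1_zero (closure A)"
  unfolding hausdorff1_zero_def
proof (intro allI impI)
  fix \<epsilon> :: real assume "\<epsilon> > 0"
  \<comment> \<open>A sum of radii below 1 keeps each radius below 1.\<close>
  then have "min \<epsilon> 1 > 0" by simp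
  then obtain S r where S: "finite S" "\<And>c. c \<in> S \<Longrightarrow> 0 < r c" "sum r S < min \<epsilon> 1"
    and cover: "closure A \<subseteq> (\<Union>c\<in>S. ball c (r c))"
    using zero_length_imp_finite_cover[OF assms] by blast
  have "r c \<le> 1" if "c \<in> S" for c
    using member_le_sum[OF that, of r] S by force
  moreover have "(\<Sum>\<^sub>\<infinity>c\<in>S. ennreal (r c)) = ennreal (sum r S)"
    using S by (simp add: sum_ennreal less_imp_le)
  moreover have "ennreal (sum r S) < ennreal \<epsilon>"
    using S \<open>\<epsilon> > 0\<close> by (simp add: ennreal_lessI)
  ultimately show "\<exists>C (r :: 'a \<Rightarrow> real). countable C \<and> (\<forall>c\<in>C. 0 < r c \<and> r c \<le> 1) \<and>
      (\<Sum>\<^sub>\<infinity>c\<in>C. ennreal (r c)) < ennreal \<epsilon> \<and> closure A \<subseteq> (\<Union>c\<in>C. ball c (r c))"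
    using S cover by (intro exI[of _ S] exI[of _ r]) (auto simp: countable_finite)
qed

lemma zero_length_closure:
  assumes "zero_length A"
  shows "zero_length (closure A)"
proof -
  have "closure A \<subseteq> closure V \<longleftrightarrow> A \<subseteq> closure V" for V
    by (metis closed_closure closure_minimal closure_subset order_trans)
  then show ?thesis using assms by (simp add: zero_length_def)
qed

theorem proposition1:
  fixes A :: "'a::metric_space set"
  assumes "zero_length A"
  shows "totally_bounded A \<and> zero_length (closure A) \<and> hausdorff1_zero (closure A)"
  using assms
  by (simp add: zero_length_imp_totally_bounded zero_length_closure
      zero_length_imp_hausdorff1_zero_closure)

end
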